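(* Let $m,n\in\mathbb{N}$ be positive integers with $2m\le n$, and let $\varphi(z)=1+z+\frac{m}{n}z^2$. If $f\in\mathcal{C}(\varphi)$ has the expansion $f(z)=z+\sum_{k=2}^{\infty}a_k z^k$ in $\mathbb{D}$, then the third Hankel determinant \[ H_3(1)=a_3(a_2a_4-a_3^2)-a_4(a_4-a_2a_3)+a_5(a_3-a_2^2) \] satisfies \[ |H_3(1)|\le \frac{1}{144}. \] Moreover, the inequality is sharp: for each such $m,n$ there is a function $f\in\mathcal{C}(\varphi)$ for which equality holds.
   Context: $\mathbb{D}=\{z\in\mathbb{C}:|z|<1\}$. $\mathcal{A}$ is the class of functions $f$ analytic in $\mathbb{D}$ with $f(0)=0$ and $f'(0)=1$. For analytic functions $g,h$ in $\mathbb{D}$, $g\prec h$ ($g$ is subordinate to $h$) means that there is an analytic function $w$ on $\mathbb{D}$ with $w(0)=0$ and $|w(z)|<1$ for all $z\in\mathbb{D}$ such that $g(z)=h(w(z))$ for all $z\in\mathbb{D}$. The class $\mathcal{C}(\varphi)$ is \[ \mathcal{C}(\varphi)=\left\{f\in\mathcal{A}: 1+\frac{z f''(z)}{f'(z)}\prec\varphi(z)\right\}. \] *)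

theory Defs
  imports "HOL-Complex_Analysis.Complex_Analysis"
begin

abbreviation unit_disc :: "complex set" where
  "unit_disc \<equiv> ball 0 1"

text \<open>Functions on the disc are total functions \<^typ>\<open>complex \<Rightarrow> complex\<close>; only their values on
  the disc are ever constrained.\<close>

definition class_A :: "(complex \<Rightarrow> complex) set" where
  "class_A = {f. f holomorphic_on unit_disc \<and> f 0 = 0 \<and> deriv f 0 = 1}"

definition subordinate :: "(complex \<Rightarrow> complex) \<Rightarrow> (complex \<Rightarrow> complex) \<Rightarrow> bool"
    (infix "\<prec>\<^sub>s" 50) where
  "g \<prec>\<^sub>s h \<longleftrightarrow>
     g holomorphic_on unit_disc \<and> h holomorphic_on unit_disc \<and>
     (\<exists>w. w holomorphic_on unit_disc \<and> w 0 = 0 \<and> (\<forall>z\<in>unit_disc. norm (w z) < 1) \<and>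
          (\<forall>z\<in>unit_disc. g z = h (w z)))"

text \<open>Since \<open>x / 0 = 0\<close> in HOL, the nonvanishing of \<open>f'\<close>, implicit in the
  quotient \<open>z f''(z) / f'(z)\<close>, is stated explicitly.\<close>

definition class_C :: "(complex \<Rightarrow> complex) \<Rightarrow> (complex \<Rightarrow> complex) set" where
  "class_C \<phi> = {f \<in> class_A. (\<forall>z\<in>unit_disc. deriv f z \<noteq> 0) \<and>
     (\<lambda>z. 1 + z * deriv (deriv f) z / deriv f z) \<prec>\<^sub>s \<phi>}"

text \<open>The expansion \<open>f(z) = z + (\<Sum>k\<ge>2. a\<^sub>k z\<^sup>k)\<close> on the disc; \<open>a 0\<close> and
  \<open>a 1\<close> are not used.\<close>

definition has_expansion :: "(complex \<Rightarrow> complex) \<Rightarrow> (nat \<Rightarrow> complex) \<Rightarrow> bool" where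
  "has_expansion f a \<longleftrightarrow>
     (\<forall>z\<in>unit_disc. (\<lambda>k. a (k + 2) * z ^ (k + 2)) sums (f z - z))"

definition hankel3 :: "(nat \<Rightarrow> complex) \<Rightarrow> complex" where
  "hankel3 a = a 3 * (a 2 * a 4 - (a 3)\<^sup>2) - a 4 * (a 4 - a 2 * a 3) + a 5 * (a 3 - (a 2)\<^sup>2)"

end

theory Submission
  imports Defs
begin

text \<open>
  Write \<open>c = m/n\<close>, so \<open>0 < c \<le> 1/2\<close>. A function \<open>f\<close> of the class satisfies
  \<open>z f''(z) = f'(z) (w(z) + c w(z)\<^sup>2)\<close> for an analytic \<open>w\<close> that maps the disc into itself and fixes
  the origin. Comparing coefficients expresses \<open>a\<^sub>2, \<dots>, a\<^sub>5\<close> through the Taylor coefficients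
  \<open>w\<^sub>1, \<dots>, w\<^sub>4\<close> of \<open>w\<close>, and the Hankel determinant becomes a polynomial in them, in which the
  only terms of degree at most two are \<open>- w\<^sub>3\<^sup>2/144\<close> and a multiple of \<open>w\<^sub>2 w\<^sub>4\<close>
  (\<open>hankel3_eq_hankel_poly\<close>).

  The sole information used about \<open>w\<close> is Bessel's inequality
  \<open>\<bar>w\<^sub>1\<bar>\<^sup>2 + \<bar>w\<^sub>2\<bar>\<^sup>2 + \<bar>w\<^sub>3\<bar>\<^sup>2 + \<bar>w\<^sub>4\<bar>\<^sup>2 \<le> 1\<close> (\<open>bessel_bounded_on_disc\<close>). Bounding every
  coefficient of the polynomial by its maximum over \<open>0 \<le> c \<le> 1/2\<close> and applying the triangle
  inequality leaves a polynomial inequality in four nonnegative reals on the unit ball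
  (\<open>hankel_majorant_le_1\<close>). It holds because near the maximum at \<open>\<bar>w\<^sub>3\<bar> = 1\<close> the
  term \<open>\<bar>w\<^sub>3\<bar>\<^sup>2\<close> drops by at least the sum of the squares of the other moduli, which dominates the cross
  terms;
  the loss in the triangle inequality is harmless elsewhere.

  The extremal function comes from \<open>w(z) = z\<^sup>3\<close>: all other coefficients vanish and only
  \<open>- 1/144\<close> remains.
\<close>

section \<open>The real polynomial inequality\<close>

text \<open>
  Substituting \<open>D\<^sup>2 \<le> 1 - A\<^sup>2 - B\<^sup>2 - E\<^sup>2\<close>, it suffices that the other terms are at most
  \<open>A\<^sup>2 + B\<^sup>2 + E\<^sup>2\<close>. The terms linear in \<open>E\<close> are absorbed by \<open>E\<^sup>2\<close> (completing the square), those
  linear in \<open>D\<close> by the arithmetic-geometric mean inequality. What remains involves only \<open>x = A\<^sup>2\<close>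
  and \<open>B\<close>, and has the form \<open>t(B) + x b(x, B) \<ge> 0\<close> with \<open>t \<ge> 0\<close> and \<open>b\<close> decreasing in \<open>x\<close>.
  If \<open>b\<close> is negative anywhere, the worst case is therefore the end point \<open>x = 1 - B\<^sup>2\<close>,
  a univariate problem.
\<close>
lemma hankel_majorant_le_1:
  fixes A B D E :: real
  assumes nn: "0 \<le> A" "0 \<le> B" "0 \<le> D" "0 \<le> E" and R: "A\<^sup>2 + B\<^sup>2 + D\<^sup>2 + E\<^sup>2 \<le> 1"
  shows "1/16 * A^6 + 1/5 * (A^4 * B) + 1/2 * (A^3 * D) + 17/20 * (A\<^sup>2 * B\<^sup>2) + 3/5 * (A\<^sup>2 * E)
           + 3/5 * (A * B * D) + 8/15 * B^3 + 6/5 * (B * E) + D\<^sup>2 \<le> 1"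
proof -
  define x where "x = A\<^sup>2"
  have x0: "0 \<le> x" and x1: "x \<le> 1 - B\<^sup>2"
    using R by (auto simp: x_def) (smt (verit) zero_le_power2)
  have B1: "B \<le> 1" using x0 x1 by (smt (verit) nn(2) one_less_power pos2)
  have E: "3/5 * (A\<^sup>2 * E) + 6/5 * (B * E) \<le> E\<^sup>2 + 9/25 * B\<^sup>2 + 9/25 * (x * B) + 9/100 * x\<^sup>2"
    using zero_le_power2[of "E - (3/5 * B + 3/10 * x)"]
    by (simp add: x_def power2_eq_square algebra_simps)
  \<comment> \<open>Here \<open>A D \<le> (A\<^sup>2 + D\<^sup>2)/2\<close> is good enough, since a factor \<open>A\<^sup>2\<close> is left over.\<close>
  have "A * D \<le> (1 - B\<^sup>2) / 2"
    using R sum_squares_bound[of A D] zero_le_power2[of E] by argo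
  then have "x * (A * D) \<le> x * ((1 - B\<^sup>2) / 2)"
    using x0 by (intro mult_left_mono)
  then have D1: "1/2 * (A^3 * D) \<le> 1/4 * (x * (1 - B\<^sup>2))"
    by (simp add: x_def power2_eq_square power3_eq_cube algebra_simps)
  \<comment> \<open>Pairing \<open>A\<close> with \<open>B D\<close> keeps the bound of second order in \<open>(A, B)\<close>; pairing \<open>A\<close> with \<open>D\<close>
    as above would leave a term linear in \<open>B\<close>.\<close>
  have "D\<^sup>2 \<le> 1 - x - B\<^sup>2"
    using R zero_le_power2[of E] unfolding x_def by linarith
  then have "B\<^sup>2 * D\<^sup>2 \<le> B\<^sup>2 * (1 - x - B\<^sup>2)"
    by (intro mult_left_mono) auto
  moreover have "2 * (A * B * D) \<le> x + B\<^sup>2 * D\<^sup>2"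
    using sum_squares_bound[of A "B * D"] by (simp add: x_def power_mult_distrib mult_ac)
  ultimately have D2: "3/5 * (A * B * D) \<le> 3/10 * x + 3/10 * (B\<^sup>2 * (1 - x - B\<^sup>2))"
    by argo
  define b where "b = 9/20 - x\<^sup>2/16 - x*B/5 - 9/100*x - 9/25*B - 3/10*B\<^sup>2"
  \<comment> \<open>\<open>b\<close> at the end point \<open>x = 1 - B\<^sup>2\<close>\<close>
  define b0 where "b0 = 9/20 - (1-B\<^sup>2)\<^sup>2/16 - (1-B\<^sup>2)*B/5 - 9/100*(1-B\<^sup>2) - 9/25*B - 3/10*B\<^sup>2"
  have b0b: "b0 \<le> b"
  proof -
    have "x\<^sup>2 \<le> (1-B\<^sup>2)\<^sup>2" using x0 x1 by (intro power_mono)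
    moreover have "x*B \<le> (1-B\<^sup>2)*B" using x1 nn by (intro mult_right_mono)
    ultimately show ?thesis using x1 unfolding b_def b0_def by argo
  qed
  define t where "t = 17/50*B\<^sup>2 - 8/15*B^3 + 3/10*B^4"
  have t0: "0 \<le> t"
  proof -
    have "t = B\<^sup>2 * (3/10 * (B - 8/9)\<^sup>2 + 139/1350)"
      unfolding t_def by (simp add: field_simps power2_eq_square eval_nat_numeral)
    then show ?thesis by simp
  qed
  have tb0: "0 \<le> t + (1 - B\<^sup>2) * b0"
  proof -
    \<comment> \<open>The polynomial is smallest near \<open>B = 7/10\<close>. Dividing it by \<open>(B - 7/10)\<^sup>2\<close> gives a positive
      quotient and a linear remainder that is positive on \<open>[0, 1]\<close>.\<close>
    have B3: "B^3 \<le> B\<^sup>2" using nn B1 by (intro power_decreasing) auto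
    have "0 \<le> B^4" by simp
    then have r: "0 \<le> 263779/480000 + 5639/12000 * B + 43/320 * B\<^sup>2 - 9/80 * B^3 + 1/16 * B^4"
      using B3 nn zero_le_power2[of B] by linarith
    have "t + (1 - B\<^sup>2) * b0 = (B - 7/10)\<^sup>2 *
        (263779/480000 + 5639/12000 * B + 43/320 * B\<^sup>2 - 9/80 * B^3 + 1/16 * B^4)
        + (1354829/48000000 - 16723/800000 * B)"
      unfolding t_def b0_def by (simp add: field_simps power2_eq_square eval_nat_numeral)
    then show ?thesis using r B1 by simp
  qed
  have key: "0 \<le> t + x * b"
  proof (cases "0 \<le> b0")
    case True
    then show ?thesis using t0 x0 b0b by simp
  next
    case False
    have "(1 - B\<^sup>2) * b0 \<le> x * b0" using False x1 by (intro mult_right_mono_neg) auto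
    also have "\<dots> \<le> x * b" using b0b x0 by (intro mult_left_mono)
    finally show ?thesis using tb0 by linarith
  qed
  have pw: "A^6 = x^3" "A^4 = x\<^sup>2" by (simp_all add: x_def flip: power_mult)
  have "t + x * b = x + B\<^sup>2 - (1/16 * x^3 + 1/5 * (x\<^sup>2 * B) + 1/4 * (x * (1 - B\<^sup>2)) + 17/20 * (x * B\<^sup>2)
     + 3/10 * x + 3/10 * (B\<^sup>2 * (1 - x - B\<^sup>2)) + 8/15 * B^3 + 9/25 * B\<^sup>2 + 9/25 * (x * B) + 9/100 * x\<^sup>2)"
    unfolding t_def b_def by (simp add: field_simps power2_eq_square eval_nat_numeral)
  then show ?thesis
    using key E D1 D2 R unfolding pw x_def[symmetric] by linarith
qed

section \<open>The Hankel determinant in terms of the Schwarz function\<close>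

text \<open>
  The value of \<open>8640 H\<^sub>3(1)\<close>; the factor \<open>8640 = 60 \<cdot> 144\<close> clears all denominators.
\<close>
definition hankel_poly :: "complex \<Rightarrow> complex \<Rightarrow> complex \<Rightarrow> complex \<Rightarrow> complex \<Rightarrow> complex" where
  "hankel_poly c w1 w2 w3 w4 =
      (- (4 * c^3) - 21 * c\<^sup>2 + 6 * c - 1) * w1^6 + (60 * c\<^sup>2 - 18 * c + 6) * (w1^4 * w2)
    + (144 * c\<^sup>2 - 36 * c + 12) * (w1^3 * w3) + (- (168 * c\<^sup>2) + 24 * c - 21) * (w1\<^sup>2 * w2\<^sup>2)
    + (72 * c - 36) * (w1\<^sup>2 * w4) + (36 - 96 * c) * (w1 * w2 * w3)
    + (72 * c - 4) * w2^3 + 72 * (w2 * w4) - 60 * w3\<^sup>2"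

text \<open>
  With \<open>P = W + c W\<^sup>2\<close>, the coefficient of \<open>z\<^sup>k\<close> in the differential equation determines
  \<open>k (k + 1) a\<^bsub>k+1\<^esub>\<close> from \<open>a\<^sub>1, \<dots>, a\<^sub>k\<close> and \<open>P\<^sub>1, \<dots>, P\<^sub>k\<close>, because \<open>P\<close> has no constant term.
\<close>
lemma hankel3_eq_hankel_poly:
  fixes F W :: "complex fps" and c :: complex
  assumes eq: "fps_X * fps_deriv (fps_deriv F) = fps_deriv F * (W + fps_const c * W\<^sup>2)"
    and F1: "fps_nth F 1 = 1" and W0: "fps_nth W 0 = 0"
  shows "8640 * hankel3 (fps_nth F)
       = hankel_poly c (fps_nth W 1) (fps_nth W 2) (fps_nth W 3) (fps_nth W 4)"
proof -
  define P where "P = W + fps_const c * W\<^sup>2"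
  define w1 w2 w3 w4 where w: "w1 = fps_nth W 1" "w2 = fps_nth W 2" "w3 = fps_nth W 3" "w4 = fps_nth W 4"
  define a2 a3 a4 a5 where a: "a2 = fps_nth F 2" "a3 = fps_nth F 3" "a4 = fps_nth F 4" "a5 = fps_nth F 5"
  have P0: "fps_nth P 0 = 0"
    using W0 by (simp add: P_def power2_eq_square)
  have P: "fps_nth P 1 = w1" "fps_nth P 2 = w2 + c * w1\<^sup>2"
    "fps_nth P 3 = w3 + 2 * c * w1 * w2" "fps_nth P 4 = w4 + c * (2 * w1 * w3 + w2\<^sup>2)"
    using W0 unfolding P_def w
    by (simp_all add: power2_eq_square fps_mult_nth numeral_eq_Suc algebra_simps)
  have rec: "fps_nth (fps_X * fps_deriv (fps_deriv F)) k = fps_nth (fps_deriv F * P) k" for k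
    using eq unfolding P_def by simp
  have r2: "2 * a2 = fps_nth P 1"
    using rec[of 1] F1 P0 unfolding a by (simp add: fps_mult_nth numeral_eq_Suc)
  have r3: "6 * a3 = fps_nth P 2 + 2 * a2 * fps_nth P 1"
    using rec[of 2] F1 P0 unfolding a by (simp add: fps_mult_nth numeral_eq_Suc algebra_simps)
  have r4: "12 * a4 = fps_nth P 3 + 2 * a2 * fps_nth P 2 + 3 * a3 * fps_nth P 1"
    using rec[of 3] F1 P0 unfolding a by (simp add: fps_mult_nth numeral_eq_Suc algebra_simps)
  have r5: "20 * a5 = fps_nth P 4 + 2 * a2 * fps_nth P 3 + 3 * a3 * fps_nth P 2 + 4 * a4 * fps_nth P 1"
    using rec[of 4] F1 P0 unfolding a by (simp add: fps_mult_nth numeral_eq_Suc algebra_simps)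
  have s2: "2 * a2 = w1"
    using r2 unfolding P .
  have s3: "6 * a3 = w2 + (c + 1) * w1\<^sup>2"
    using r3 s2 unfolding P by algebra
  have s4: "24 * a4 = 2 * w3 + (4 * c + 3) * (w1 * w2) + (3 * c + 1) * w1^3"
    using r4 s2 s3 unfolding P by algebra
  have s5: "120 * a5 = 6 * w4 + (12 * c + 8) * (w1 * w3) + (6 * c + 3) * w2\<^sup>2
      + (22 * c + 6) * (w1\<^sup>2 * w2) + (3 * c\<^sup>2 + 6 * c + 1) * w1^4"
    using r5 s2 s3 s4 unfolding P by algebra
  \<comment> \<open>The determinant is first written in the multiples of the \<open>a\<^sub>k\<close> that are integral in \<open>c\<close> and the
    \<open>w\<^sub>k\<close>, so that the substitution takes place between polynomials with integer coefficients.\<close>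
  have "8640 * (a3 * (a2 * a4 - a3\<^sup>2) - a4 * (a4 - a2 * a3) + a5 * (a3 - a2\<^sup>2))
      = 60 * ((2 * a2) * (6 * a3) * (24 * a4)) - 40 * (6 * a3)^3 - 15 * (24 * a4)\<^sup>2
        + 12 * ((120 * a5) * (6 * a3)) - 18 * ((120 * a5) * (2 * a2)\<^sup>2)"
    by algebra
  also have "\<dots> = hankel_poly c w1 w2 w3 w4"
    unfolding s2 s3 s4 s5 hankel_poly_def by algebra
  finally show ?thesis
    unfolding hankel3_def a w .
qed

text \<open>
  The constants in \<open>hankel_majorant_le_1\<close> are, up to the factor \<open>60\<close>, the maxima over
  \<open>0 \<le> c \<le> 1/2\<close> of the moduli of the coefficients of \<open>hankel_poly\<close>.
\<close>
lemma norm_hankel_poly_le: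
  fixes c :: real and a b d e :: complex
  assumes c: "0 \<le> c" "c \<le> 1/2"
    and R: "(norm a)\<^sup>2 + (norm b)\<^sup>2 + (norm d)\<^sup>2 + (norm e)\<^sup>2 \<le> 1"
  shows "norm (hankel_poly (of_real c) a b d e) \<le> 60"
proof -
  have c2: "c\<^sup>2 \<le> c / 2" "0 \<le> c\<^sup>2"
    using mult_left_mono[OF c(2) c(1)] by (auto simp: power2_eq_square)
  have c3: "c^3 \<le> c\<^sup>2 / 2" "0 \<le> c^3"
    using mult_left_mono[OF c(2) c2(2)] c(1) by (auto simp: power3_eq_cube power2_eq_square)
  have k: "\<bar>- (4 * c^3) - 21 * c\<^sup>2 + 6 * c - 1\<bar> \<le> 15/4" "\<bar>60 * c\<^sup>2 - 18 * c + 6\<bar> \<le> 12"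
    "\<bar>144 * c\<^sup>2 - 36 * c + 12\<bar> \<le> 30" "\<bar>- (168 * c\<^sup>2) + 24 * c - 21\<bar> \<le> 51"
    "\<bar>72 * c - 36\<bar> \<le> 36" "\<bar>36 - 96 * c\<bar> \<le> 36" "\<bar>72 * c - 4\<bar> \<le> 32" "\<bar>72 :: real\<bar> \<le> 72" "\<bar>60 :: real\<bar> \<le> 60"
    unfolding abs_le_iff by (intro conjI; use c c2 c3 in linarith)+
  have nm: "norm (of_real x * z :: complex) \<le> y * norm z" if "\<bar>x\<bar> \<le> y" for x y z
    using that by (simp add: norm_mult mult_right_mono)
  have triangle: "norm (t1 + t2 + t3 + t4 + t5 + t6 + t7 + t8 - t9) \<le> norm t1 + norm t2 + norm t3
      + norm t4 + norm t5 + norm t6 + norm t7 + norm t8 + norm t9" for t1 t2 t3 t4 t5 t6 t7 t8 t9 :: complex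
    by (intro norm_triangle_le_diff norm_triangle_le add_mono order_refl)
  have "norm (hankel_poly (of_real c) a b d e) = norm (
      of_real (- (4 * c^3) - 21 * c\<^sup>2 + 6 * c - 1) * a^6 + of_real (60 * c\<^sup>2 - 18 * c + 6) * (a^4 * b)
    + of_real (144 * c\<^sup>2 - 36 * c + 12) * (a^3 * d) + of_real (- (168 * c\<^sup>2) + 24 * c - 21) * (a\<^sup>2 * b\<^sup>2)
    + of_real (72 * c - 36) * (a\<^sup>2 * e) + of_real (36 - 96 * c) * (a * b * d)
    + of_real (72 * c - 4) * b^3 + of_real 72 * (b * e) - of_real 60 * d\<^sup>2)"
    by (simp add: hankel_poly_def)
  also have "\<dots> \<le> 15/4 * norm (a^6) + 12 * norm (a^4 * b) + 30 * norm (a^3 * d)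
    + 51 * norm (a\<^sup>2 * b\<^sup>2) + 36 * norm (a\<^sup>2 * e) + 36 * norm (a * b * d) + 32 * norm (b^3)
    + 72 * norm (b * e) + 60 * norm (d\<^sup>2)"
    by (rule order_trans[OF triangle]) (intro add_mono k[THEN nm])
  also have "\<dots> \<le> 60"
    using hankel_majorant_le_1[OF norm_ge_zero norm_ge_zero norm_ge_zero norm_ge_zero R]
    unfolding norm_mult norm_power by argo
  finally show ?thesis .
qed

section \<open>Bessel's inequality for bounded analytic functions\<close>

text \<open>
  Cauchy's formula for the derivatives at the centre, read as a Fourier coefficient of \<open>f\<close>
  on the circle of radius \<open>r\<close>.
\<close>
lemma has_integral_taylor_coeff:
  fixes f :: "complex \<Rightarrow> complex" and r :: real
  assumes holf: "f holomorphic_on ball 0 1" and F: "f has_fps_expansion F" and r: "0 < r" "r < 1"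
  shows "((\<lambda>t. f (of_real r * cis t) * cis (- (real k * t))) has_integral (2 * pi * of_real r ^ k * fps_nth F k)) {0..2*pi}"
proof -
  have "((\<lambda>u. f u / (u-0) ^ (Suc k)) has_contour_integral ((2 * pi * \<i>) / (fact k) * (deriv ^^ k) f 0))
           (circlepath 0 r)"
    using r by (intro Cauchy_has_contour_integral_higher_derivative_circlepath
        holomorphic_on_imp_continuous_on holomorphic_on_subset[OF holf]) auto
  then have "((\<lambda>t. f (r * cis t) / (r * cis t) ^ Suc k * r * \<i> * cis t) has_integral
      (2 * pi * \<i> * fps_nth F k)) {0..2*pi}"
    unfolding circlepath_def by (subst (asm) has_contour_integral_part_circlepath_iff)
       (simp_all add: fps_nth_fps_expansion[OF F])
  from has_integral_mult_right[OF this, of "of_real r ^ k / \<i>"]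
  show ?thesis
  proof (rule has_integral_eq_rhs[OF has_integral_eq, rotated])
    fix t
    have "cis (- (real k * t)) = 1 / cis t ^ k"
      by (simp add: Complex.DeMoivre cis_divide[symmetric] flip: cis_inverse inverse_eq_divide)
    then show "of_real r ^ k / \<i> * (f (r * cis t) / (r * cis t) ^ Suc k * r * \<i> * cis t) = f (r * cis t) * cis (- (real k * t))"
      using r by (simp add: field_simps)
  qed (simp add: field_simps)
qed

text \<open>
  Let \<open>p\<close> be the Taylor polynomial of degree \<open>n\<close>. On the circle of radius \<open>r\<close>, both
  \<open>f \<cdot> cnj p\<close> and \<open>p \<cdot> cnj p\<close> have mean \<open>S = (\<Sum>k\<le>n. \<bar>c\<^sub>k\<bar>\<^sup>2 r\<^bsup>2k\<^esup>)\<close>. Integrating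
  \<open>2 Re (f \<cdot> cnj p) - \<bar>p\<bar>\<^sup>2 = \<bar>f\<bar>\<^sup>2 - \<bar>f - p\<bar>\<^sup>2 \<le> 1\<close> gives \<open>S \<le> 1\<close>, and then \<open>r\<close> tends to \<open>1\<close>.
\<close>
lemma bessel_bounded_on_disc:
  fixes f :: "complex \<Rightarrow> complex"
  assumes holf: "f holomorphic_on ball 0 1" and F: "f has_fps_expansion F"
    and bd: "\<And>z. z \<in> ball 0 1 \<Longrightarrow> norm (f z) \<le> 1"
  shows "(\<Sum>k\<le>n. (norm (fps_nth F k))\<^sup>2) \<le> 1"
proof -
  have le: "(\<Sum>k\<le>n. (norm (fps_nth F k))\<^sup>2 * r ^ (2 * k)) \<le> 1" if r: "0 < r" "r < 1" for r :: real
  proof -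
    define p where "p z = (\<Sum>k\<le>n. fps_nth F k * z ^ k)" for z
    define S where "S = (\<Sum>k\<le>n. (norm (fps_nth F k))\<^sup>2 * r ^ (2 * k))"
    have holp: "p holomorphic_on ball 0 1"
      unfolding p_def by (intro holomorphic_intros)
    have P: "p has_fps_expansion (\<Sum>k\<le>n. fps_const (fps_nth F k) * fps_X ^ k)"
      unfolding p_def by (intro fps_expansion_intros)
    have Pk: "fps_nth (\<Sum>k\<le>n. fps_const (fps_nth F k) * fps_X ^ k) k = fps_nth F k" if "k \<le> n" for k
      using that by (simp add: fps_sum_nth fps_X_power_nth if_distrib cong: if_cong)
    \<comment> \<open>Stated for any \<open>g\<close> with the same coefficients up to \<open>n\<close>, so that it covers both \<open>f\<close> and \<open>p\<close>.\<close>
    have inner: "((\<lambda>t. g (of_real r * cis t) * cnj (p (of_real r * cis t))) has_integral of_real (2 * pi * S)) {0..2*pi}"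
      if g: "g holomorphic_on ball 0 1" "g has_fps_expansion G" and Gk: "\<And>k. k \<le> n \<Longrightarrow> fps_nth G k = fps_nth F k" for g G
    proof -
      have "((\<lambda>t. \<Sum>k\<le>n. (cnj (fps_nth F k) * of_real r ^ k) * (g (of_real r * cis t) * cis (- (real k * t)))) has_integral
          (\<Sum>k\<le>n. (cnj (fps_nth F k) * of_real r ^ k) * (2 * pi * of_real r ^ k * fps_nth G k))) {0..2*pi}"
        by (intro has_integral_sum has_integral_mult_right has_integral_taylor_coeff g r) auto
      moreover have "(\<Sum>k\<le>n. (cnj (fps_nth F k) * of_real r ^ k) * (g (of_real r * cis t) * cis (- (real k * t))))
         = g (of_real r * cis t) * cnj (p (of_real r * cis t))" for t
        by (simp add: p_def sum_distrib_left power_mult_distrib Complex.DeMoivre cis_cnj mult_ac)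
      moreover have "(\<Sum>k\<le>n. (cnj (fps_nth F k) * of_real r ^ k) * (2 * pi * of_real r ^ k * fps_nth G k)) = of_real (2 * pi * S)"
        unfolding S_def sum_distrib_left of_real_sum
      proof (intro sum.cong refl)
        fix k assume "k \<in> {..n}"
        moreover have "complex_of_real (r ^ (2 * k)) = of_real r ^ k * of_real r ^ k"
          by (simp add: power_even_eq power2_eq_square)
        ultimately show "(cnj (fps_nth F k) * of_real r ^ k) * (2 * pi * of_real r ^ k * fps_nth G k) =
            of_real (2 * pi * ((norm (fps_nth F k))\<^sup>2 * r ^ (2 * k)))"
          unfolding of_real_mult complex_norm_square
          by (simp add: Gk)
      qed
      ultimately show ?thesis by simp
    qed
    have "((\<lambda>t. 2 * Re (f (of_real r * cis t) * cnj (p (of_real r * cis t))) -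
        Re (p (of_real r * cis t) * cnj (p (of_real r * cis t)))) has_integral (2 * (2 * pi * S) - 2 * pi * S)) {0..2*pi}"
      using has_integral_Re[OF inner[OF holf F]] has_integral_Re[OF inner[OF holp P Pk]]
      by (intro has_integral_diff has_integral_mult_right) auto
    moreover have "((\<lambda>t. 1 :: real) has_integral (2 * pi)) {0..2*pi}"
      using has_integral_const_real[of "1::real" 0 "2*pi"] by simp
    moreover have "2 * Re (f z * cnj (p z)) - Re (p z * cnj (p z)) \<le> 1" if "z \<in> ball 0 1" for z
    proof -
      have "0 \<le> (norm (f z - p z))\<^sup>2" by simp
      also have "(norm (f z - p z))\<^sup>2 = (norm (f z))\<^sup>2 - (2 * Re (f z * cnj (p z)) - Re (p z * cnj (p z)))"
        unfolding cmod_power2 by (simp add: power2_eq_square algebra_simps)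
      also have "(norm (f z))\<^sup>2 \<le> 1"
        using bd[OF that] by (simp add: power_le_one)
      finally show ?thesis by simp
    qed
    ultimately have "2 * (2 * pi * S) - 2 * pi * S \<le> 2 * pi"
      using r by (elim has_integral_le) (auto simp: norm_mult)
    then show ?thesis unfolding S_def[symmetric] by simp
  qed
  have "((\<lambda>r. \<Sum>k\<le>n. (norm (fps_nth F k))\<^sup>2 * r ^ (2 * k)) \<longlongrightarrow> (\<Sum>k\<le>n. (norm (fps_nth F k))\<^sup>2 * 1 ^ (2 * k))) (at_left 1)"
    by (intro tendsto_intros)
  moreover have "\<forall>\<^sub>F r in at_left (1 :: real). r \<in> {0<..<1}"
    by (rule eventually_at_left_real) simp
  then have "\<forall>\<^sub>F r in at_left 1. (\<Sum>k\<le>n. (norm (fps_nth F k))\<^sup>2 * r ^ (2 * k)) \<le> 1"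
    by eventually_elim (use le in auto)
  ultimately have "(\<Sum>k\<le>n. (norm (fps_nth F k))\<^sup>2 * 1 ^ (2 * k)) \<le> 1"
    by (intro tendsto_upperbound) auto
  then show ?thesis by simp
qed

section \<open>From the function class to formal power series\<close>

lemma eventually_in_unit_disc: "\<forall>\<^sub>F z in nhds 0. z \<in> unit_disc"
  by (rule eventually_nhds_in_open) auto

lemma has_fps_expansion_of_has_expansion:
  assumes "has_expansion f a"
  shows "f has_fps_expansion Abs_fps (\<lambda>k. if k = 0 then 0 else if k = 1 then 1 else a k)"
    (is "_ has_fps_expansion ?F")
proof -
  have s: "(\<lambda>k. fps_nth ?F k * z ^ k) sums f z" if "z \<in> unit_disc" for z
  proof -
    have "(\<lambda>k. fps_nth ?F (k + 2) * z ^ (k + 2)) sums (f z - z)"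
      using assms that by (simp add: has_expansion_def)
    then show ?thesis
      by (subst (asm) sums_iff_shift) (simp add: numeral_eq_Suc)
  qed
  have "norm (1/2 :: complex) \<le> conv_radius (fps_nth ?F)"
    using s[of "1/2"] by (intro conv_radius_geI) (simp add: sums_iff)
  then have "fps_conv_radius ?F > 0"
    unfolding fps_conv_radius_def by (rule less_le_trans[rotated]) simp
  moreover have "\<forall>\<^sub>F z in nhds 0. eval_fps ?F z = f z"
    using eventually_in_unit_disc by eventually_elim (use s in \<open>auto simp: eval_fps_def sums_iff\<close>)
  ultimately show ?thesis by (simp add: has_fps_expansion_def)
qed

lemma fps_of_subordination_ode:
  assumes ode: "\<And>z. z \<in> unit_disc \<Longrightarrow> z * deriv (deriv f) z = deriv f z * (w z + c * (w z)\<^sup>2)"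
    and F: "f has_fps_expansion F" and W: "w has_fps_expansion W"
  shows "fps_X * fps_deriv (fps_deriv F) = fps_deriv F * (W + fps_const c * W\<^sup>2)"
proof (rule fps_expansion_unique_complex)
  show "(\<lambda>z. z * deriv (deriv f) z) has_fps_expansion fps_X * fps_deriv (fps_deriv F)"
    by (intro fps_expansion_intros F)
  have "(\<lambda>z. deriv f z * (w z + c * (w z)\<^sup>2)) has_fps_expansion fps_deriv F * (W + fps_const c * W\<^sup>2)"
    unfolding power2_eq_square by (intro fps_expansion_intros F W)
  moreover have "\<forall>\<^sub>F z in nhds 0. z * deriv (deriv f) z = deriv f z * (w z + c * (w z)\<^sup>2)"
    using eventually_in_unit_disc by eventually_elim (use ode in auto)
  ultimately show "(\<lambda>z. z * deriv (deriv f) z) has_fps_expansion fps_deriv F * (W + fps_const c * W\<^sup>2)"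
    by (subst has_fps_expansion_cong) auto
qed

section \<open>The bound and its sharpness\<close>

lemma norm_hankel3_le:
  fixes c :: real
  assumes c: "0 \<le> c" "c \<le> 1/2" and f: "f \<in> class_C (\<lambda>z. 1 + z + of_real c * z\<^sup>2)"
    and a: "has_expansion f a"
  shows "norm (hankel3 a) \<le> 1/144"
proof -
  define F where "F = Abs_fps (\<lambda>k. if k = 0 then 0 else if k = 1 then 1 else a k)"
  have F: "f has_fps_expansion F"
    using has_fps_expansion_of_has_expansion[OF a] by (simp add: F_def)
  from f obtain w where holw: "w holomorphic_on unit_disc" and w0: "w 0 = 0"
    and w1: "\<And>z. z \<in> unit_disc \<Longrightarrow> norm (w z) < 1"
    and sub: "\<And>z. z \<in> unit_disc \<Longrightarrow> 1 + z * deriv (deriv f) z / deriv f z = 1 + w z + of_real c * (w z)\<^sup>2"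
    and nz: "\<And>z. z \<in> unit_disc \<Longrightarrow> deriv f z \<noteq> 0"
    unfolding class_C_def subordinate_def by blast
  define W where "W = fps_expansion w 0"
  have W: "w has_fps_expansion W"
    unfolding W_def using holw by (intro has_fps_expansion_fps_expansion[of unit_disc]) auto
  have W0: "fps_nth W 0 = 0"
    using fps_nth_fps_expansion[OF W, of 0] w0 by simp
  have "z * deriv (deriv f) z = deriv f z * (w z + of_real c * (w z)\<^sup>2)" if "z \<in> unit_disc" for z
    using sub[OF that] nz[OF that] by (simp add: field_simps)
  then have eq: "fps_X * fps_deriv (fps_deriv F) = fps_deriv F * (W + fps_const (of_real c) * W\<^sup>2)"
    by (rule fps_of_subordination_ode[OF _ F W])
  have "(\<Sum>k\<le>4. (norm (fps_nth W k))\<^sup>2) \<le> 1"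
    using w1 by (intro bessel_bounded_on_disc[OF holw W]) (auto intro: less_imp_le)
  then have R: "(norm (fps_nth W 1))\<^sup>2 + (norm (fps_nth W 2))\<^sup>2 + (norm (fps_nth W 3))\<^sup>2 + (norm (fps_nth W 4))\<^sup>2 \<le> 1"
    using W0 by (simp add: numeral_eq_Suc)
  have "8640 * norm (hankel3 (fps_nth F)) = norm (8640 * hankel3 (fps_nth F))"
    by (simp add: norm_mult)
  also have "\<dots> \<le> 60"
    using norm_hankel_poly_le[OF c R] by (subst hankel3_eq_hankel_poly[OF eq _ W0]) (auto simp: F_def)
  also have "hankel3 (fps_nth F) = hankel3 a"
    by (simp add: hankel3_def F_def)
  finally show ?thesis by simp
qed

text \<open>
  For \<open>w(z) = z\<^sup>3\<close> the equation \<open>f''/f' = (w + c w\<^sup>2)/z = z\<^sup>2 + c z\<^sup>5\<close> integrates to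
  \<open>f' = exp (z\<^sup>3/3 + c z\<^sup>6/6)\<close>; a primitive of this entire function is extremal.
\<close>
lemma hankel3_bound_attained:
  fixes c :: complex
  shows "\<exists>f a. f \<in> class_C (\<lambda>z. 1 + z + c * z\<^sup>2) \<and> has_expansion f a \<and> norm (hankel3 a) = 1/144"
proof -
  define h where "h z = exp (z^3/3 + c * z^6/6)" for z
  have "h holomorphic_on unit_disc"
    unfolding h_def by (intro holomorphic_intros) auto
  then obtain g where g: "\<And>z. z \<in> unit_disc \<Longrightarrow> (g has_field_derivative h z) (at z within unit_disc)"
    using holomorphic_convex_primitive'[of unit_disc h] by auto
  define f where "f z = g z - g 0" for z
  have f': "(f has_field_derivative h z) (at z)" if "z \<in> unit_disc" for z
    using g[OF that] that unfolding f_def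
    by (auto intro!: derivative_eq_intros simp: at_within_open[OF that])
  have df: "deriv f z = h z" if "z \<in> unit_disc" for z
    using f'[OF that] by (rule DERIV_imp_deriv)
  have h': "(h has_field_derivative (h z * (z\<^sup>2 + c * z^5))) (at z)" for z
    unfolding h_def by (auto intro!: derivative_eq_intros simp: field_simps)
  have ddf: "deriv (deriv f) z = h z * (z\<^sup>2 + c * z^5)" if "z \<in> unit_disc" for z
  proof -
    have "(deriv f has_field_derivative (h z * (z\<^sup>2 + c * z^5))) (at z)"
      using h'[of z] that df by (subst DERIV_cong_ev[OF refl _ refl, of _ h])
         (auto intro: eventually_mono[OF eventually_nhds_in_open[of unit_disc z]])
    then show ?thesis by (rule DERIV_imp_deriv)
  qed
  have ode: "z * deriv (deriv f) z = deriv f z * (z^3 + c * (z^3)\<^sup>2)" if "z \<in> unit_disc" for z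
    using df[OF that] ddf[OF that] by (simp add: algebra_simps eval_nat_numeral)
  have holf: "f holomorphic_on unit_disc"
    using f' by (metis holomorphic_on_open open_ball)
  have nz: "deriv f z \<noteq> 0" if "z \<in> unit_disc" for z
    using df[OF that] by (simp add: h_def)
  have quot: "1 + z * deriv (deriv f) z / deriv f z = 1 + z^3 + c * (z^3)\<^sup>2" if "z \<in> unit_disc" for z
    using ode[OF that] nz[OF that] by (simp add: field_simps)
  have f0: "f 0 = 0" "deriv f 0 = 1"
    using df[of 0] by (auto simp: f_def h_def)
  have "(\<lambda>z. 1 + z * deriv (deriv f) z / deriv f z) holomorphic_on unit_disc"
    using holf nz by (intro holomorphic_intros) auto
  moreover have "(\<lambda>z. 1 + z + c * z\<^sup>2) holomorphic_on unit_disc"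
    by (intro holomorphic_intros)
  moreover have "\<exists>w. w holomorphic_on unit_disc \<and> w 0 = 0 \<and> (\<forall>z\<in>unit_disc. norm (w z) < 1) \<and>
          (\<forall>z\<in>unit_disc. 1 + z * deriv (deriv f) z / deriv f z = 1 + w z + c * (w z)\<^sup>2)"
    using quot by (intro exI[of _ "\<lambda>z. z^3"])
      (auto intro!: holomorphic_intros simp: norm_power power_less_one_iff)
  ultimately have fC: "f \<in> class_C (\<lambda>z. 1 + z + c * z\<^sup>2)"
    using holf f0 nz unfolding class_C_def subordinate_def class_A_def by blast
  define F where "F = fps_expansion f 0"
  have F: "f has_fps_expansion F"
    unfolding F_def using holf by (intro has_fps_expansion_fps_expansion[of unit_disc]) auto
  have F01: "fps_nth F 0 = 0" "fps_nth F 1 = 1"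
    using fps_nth_fps_expansion[OF F, of 0] fps_nth_fps_expansion[OF F, of 1] f0 by auto
  have exp: "has_expansion f (fps_nth F)"
    unfolding has_expansion_def
  proof
    fix z assume z: "z \<in> unit_disc"
    have "(\<lambda>k. fps_nth F k * z ^ k) sums f z"
      using holomorphic_power_series[OF holf z] by (simp add: fps_nth_fps_expansion[OF F])
    then show "(\<lambda>k. fps_nth F (k + 2) * z ^ (k + 2)) sums (f z - z)"
      using F01 by (subst sums_iff_shift) (simp add: numeral_eq_Suc)
  qed
  have eq: "fps_X * fps_deriv (fps_deriv F) = fps_deriv F * (fps_X^3 + fps_const c * (fps_X^3)\<^sup>2)"
    by (intro fps_of_subordination_ode[OF ode] F fps_expansion_intros)
  have X: "fps_nth (fps_X^3 :: complex fps) k = (if k = 3 then 1 else 0)" for k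
    by (rule fps_X_power_nth)
  have X0: "fps_nth (fps_X^3 :: complex fps) 0 = 0" "fps_nth (fps_X^3 :: complex fps) 1 = 0"
    "fps_nth (fps_X^3 :: complex fps) 2 = 0" "fps_nth (fps_X^3 :: complex fps) 3 = 1"
    "fps_nth (fps_X^3 :: complex fps) 4 = 0"
    unfolding X by simp_all
  have "8640 * hankel3 (fps_nth F) = hankel_poly c 0 0 1 0"
    using hankel3_eq_hankel_poly[OF eq F01(2) X0(1)] unfolding X0 .
  also have "\<dots> = - 60"
    by (simp add: hankel_poly_def)
  finally have h: "8640 * hankel3 (fps_nth F) = - 60" .
  have "8640 * norm (hankel3 (fps_nth F)) = norm (8640 * hankel3 (fps_nth F))"
    by (simp only: norm_mult norm_numeral)
  also have "\<dots> = 60"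
    unfolding h by simp
  finally have "norm (hankel3 (fps_nth F)) = 1/144" by simp
  with fC exp show ?thesis by blast
qed

theorem theorem3p2:
  fixes m n :: nat and \<phi> :: "complex \<Rightarrow> complex"
  assumes "m > 0" and "n > 0" and "2 * m \<le> n"
    and "\<phi> = (\<lambda>z. 1 + z + (of_nat m / of_nat n) * z\<^sup>2)"
  shows "(\<forall>f a. f \<in> class_C \<phi> \<longrightarrow> has_expansion f a \<longrightarrow> norm (hankel3 a) \<le> 1 / 144) \<and>
         (\<exists>f a. f \<in> class_C \<phi> \<and> has_expansion f a \<and> norm (hankel3 a) = 1 / 144)"
proof -
  define c where "c = real m / real n"
  have \<phi>: "\<phi> = (\<lambda>z. 1 + z + of_real c * z\<^sup>2)"
    using assms(4) by (simp add: c_def)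
  have "real (2 * m) \<le> real n" using assms(3) by (rule of_nat_mono)
  then have "0 \<le> c" "c \<le> 1/2"
    using assms(2) by (auto simp: c_def field_simps)
  then show ?thesis
    unfolding \<phi> using norm_hankel3_le hankel3_bound_attained by blast
qed

end
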